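(* Suppose that $\mathfrak{P}_+$ is nonempty and that $\int_K \frac{1}{Q}\,dx=\infty$ for all $q\in\partial\mathfrak{P}_+$. Let $p\in\mathfrak{P}_+$. Then the map $f^p:\mathfrak{P}_+\to\mathfrak{C}_+$, $f^p(q)=\int_K\alpha\frac{P}{Q}\,dx$, is a diffeomorphism between $\mathfrak{P}_+$ and $\mathfrak{C}_+$.
   Context: $K\subset\mathbb{R}^d$ is a compact set with $d$-dimensional (nonempty) interior whose closure is precisely $K$; $dx$ is Lebesgue measure. $\alpha_1,\dots,\alpha_n$ are real-valued, continuous, linearly independent functions on $K$, and $\alpha=(\alpha_1,\dots,\alpha_n)'$ is the corresponding column vector of functions. For $p,q\in\mathbb{R}^n$ write $P(x)=\sum_{k=1}^n p_k\alpha_k(x)$, $Q(x)=\sum_{k=1}^n q_k\alpha_k(x)$. $\mathfrak{P}_+$ is the set of $p\in\mathbb{R}^n$ such that $P(x)>0$ for all $x\in K$; $\bar{\mathfrak{P}}_+$ is its closure and $\partial\mathfrak{P}_+=\bar{\mathfrak{P}}_+\setminus\mathfrak{P}_+$. Standing assumption: for every $p\in\bar{\mathfrak{P}}_+\setminus\{0\}$ the zero set of $P$ in $K$ has Lebesgue measure zero. With $\langle c,p\rangle=\sum_{k=1}^n c_kp_k$, let $\mathfrak{C}_+=\{c\in\mathbb{R}^n\mid \langle c,p\rangle>0 \text{ for all } p\in\bar{\mathfrak{P}}_+\setminus\{0\}\}$. Where $Q(x)=0$, $1/Q(x)$ is read as $+\infty$. *)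

theory Defs
  imports "HOL-Analysis.Analysis"
begin

definition lin_comb :: "('n::finite \<Rightarrow> 'a \<Rightarrow> real) \<Rightarrow> real ^ 'n \<Rightarrow> 'a \<Rightarrow> real" where
  "lin_comb \<alpha> p x = (\<Sum>k\<in>UNIV. p $ k * \<alpha> k x)"

text \<open>Linear independence of the family of restrictions of the \<open>\<alpha> k\<close> to \<open>K\<close>; the values of
  \<open>\<alpha> k\<close> outside \<open>K\<close> are irrelevant throughout.\<close>

definition lin_indep_on :: "'a set \<Rightarrow> ('n::finite \<Rightarrow> 'a \<Rightarrow> real) \<Rightarrow> bool" where
  "lin_indep_on K \<alpha> \<longleftrightarrow> (\<forall>p :: real ^ 'n. (\<forall>x\<in>K. lin_comb \<alpha> p x = 0) \<longrightarrow> p = 0)"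

definition pos_cone :: "'a set \<Rightarrow> ('n::finite \<Rightarrow> 'a \<Rightarrow> real) \<Rightarrow> (real ^ 'n) set" where
  "pos_cone K \<alpha> = {p. \<forall>x\<in>K. lin_comb \<alpha> p x > 0}"

definition pos_cone_boundary :: "'a set \<Rightarrow> ('n::finite \<Rightarrow> 'a \<Rightarrow> real) \<Rightarrow> (real ^ 'n) set" where
  "pos_cone_boundary K \<alpha> = closure (pos_cone K \<alpha>) - pos_cone K \<alpha>"

definition dual_cone :: "'a set \<Rightarrow> ('n::finite \<Rightarrow> 'a \<Rightarrow> real) \<Rightarrow> (real ^ 'n) set" where
  "dual_cone K \<alpha> = {c. \<forall>p \<in> closure (pos_cone K \<alpha>) - {0}. c \<bullet> p > 0}"

text \<open>The integral of \<open>1 / Q\<close> over \<open>K\<close> for \<open>Q \<ge> 0\<close> on \<open>K\<close>, as an extended nonnegative real.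
  The quotient is taken in \<^typ>\<open>ennreal\<close>, where \<open>1 / 0 = \<infinity>\<close>; in \<^typ>\<open>real\<close> it would be \<open>0\<close>.\<close>

definition recip_integral ::
    "(real ^ 'd) set \<Rightarrow> ('n::finite \<Rightarrow> real ^ 'd \<Rightarrow> real) \<Rightarrow> real ^ 'n \<Rightarrow> ennreal" where
  "recip_integral K \<alpha> q = (\<integral>\<^sup>+x\<in>K. (1 / ennreal (lin_comb \<alpha> q x)) \<partial>lborel)"

lemma one_div_zero_ennreal: "(1 :: ennreal) / 0 = \<infinity>"
  by (simp add: divide_ennreal_def)

lemma pos_cone_boundary_nonneg:
  assumes "q \<in> closure (pos_cone K \<alpha>)" "x \<in> K"
  shows "lin_comb \<alpha> q x \<ge> 0"
proof -
  have "closed {q. lin_comb \<alpha> q x \<ge> 0}"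
    unfolding lin_comb_def by (intro closed_Collect_le continuous_intros)
  moreover have "pos_cone K \<alpha> \<subseteq> {q. lin_comb \<alpha> q x \<ge> 0}"
    using assms(2) by (auto simp: pos_cone_def intro: less_imp_le)
  ultimately show ?thesis
    using assms(1) closure_minimal by blast
qed

definition moment_map ::
    "(real ^ 'd) set \<Rightarrow> ('n::finite \<Rightarrow> real ^ 'd \<Rightarrow> real) \<Rightarrow> real ^ 'n \<Rightarrow> real ^ 'n \<Rightarrow> real ^ 'n" where
  "moment_map K \<alpha> p q =
     (\<chi> k. LINT x:K|lborel. \<alpha> k x * (lin_comb \<alpha> p x / lin_comb \<alpha> q x))"

text \<open>\<open>C\<^sup>m\<close> maps on open sets: continuous for \<open>m = 0\<close>; for \<open>m + 1\<close>, differentiable with every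
  directional derivative \<open>C\<^sup>m\<close>. Derivatives are two-sided (\<open>at x\<close>), so this is meant for open \<open>S\<close>.\<close>

primrec C_k_on ::
    "nat \<Rightarrow> 'a::real_normed_vector set \<Rightarrow> ('a \<Rightarrow> 'b::real_normed_vector) \<Rightarrow> bool" where
  "C_k_on 0 S f \<longleftrightarrow> continuous_on S f"
| "C_k_on (Suc m) S f \<longleftrightarrow>
     (\<forall>x\<in>S. f differentiable (at x)) \<and>
     (\<forall>v. C_k_on m S (\<lambda>x. frechet_derivative f (at x) v))"

definition smooth_on ::
    "'a::real_normed_vector set \<Rightarrow> ('a \<Rightarrow> 'b::real_normed_vector) \<Rightarrow> bool" where
  "smooth_on S f \<longleftrightarrow> (\<forall>m. C_k_on m S f)"

definition diffeomorphism_between ::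
    "'a::real_normed_vector set \<Rightarrow> 'b::real_normed_vector set \<Rightarrow> ('a \<Rightarrow> 'b) \<Rightarrow> bool" where
  "diffeomorphism_between S T f \<longleftrightarrow>
     open S \<and> open T \<and> bij_betw f S T \<and> smooth_on S f \<and> smooth_on T (inv_into S f)"

end

theory Submission
  imports Defs
begin

text \<open>Monotonicity does most of the work: \<open>\<langle>q - r, f(r) - f(q)\<rangle> = \<integral> P (Q - R)\<^sup>2 / (Q R)\<close> gives injectivity, and
  its infinitesimal version \<open>\<langle>v, Df(q) v\<rangle> = - \<integral> P V\<^sup>2 / Q\<^sup>2\<close> gives invertibility of the derivative.
  The image is open by invariance of domain, so, the dual cone being connected, surjectivity follows
  once the image is closed in it. If \<open>f(q\<^sub>n) \<rightarrow> c\<close> with \<open>c\<close> in the dual cone, then \<open>\<langle>c, q\<rangle> \<ge> \<epsilon> |q|\<close> on the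
  closed cone together with \<open>\<langle>f(q\<^sub>n), q\<^sub>n\<rangle> = \<integral> P\<close> bounds the \<open>q\<^sub>n\<close>; a limit point on the boundary is excluded
  because \<open>\<langle>f(q\<^sub>n), p\<rangle> = \<integral> P\<^sup>2 / Q\<^sub>n\<close> stays bounded while \<open>\<integral> 1 / Q\<close> is infinite there (Fatou).\<close>

subsection \<open>Calculus of \<open>C\<^sup>m\<close> maps\<close>

text \<open>Frechet derivatives only see a neighbourhood of the point, so on an open set agreement
  of functions passes to their directional derivatives and the induction goes on.\<close>

lemma C_k_on_cong:
  assumes "open S" "\<And>x. x \<in> S \<Longrightarrow> f x = g x" "C_k_on m S f"
  shows "C_k_on m S g"
  using assms(2,3)
proof (induction m arbitrary: f g)
  case 0
  then show ?case
    by (simp cong: continuous_on_cong)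
next
  case (Suc m)
  have *: "(g has_derivative frechet_derivative f (at x)) (at x)" if "x \<in> S" for x
  proof -
    have "(f has_derivative frechet_derivative f (at x)) (at x)"
      using Suc.prems(2) that by (simp flip: frechet_derivative_works)
    then show ?thesis
      using has_derivative_transform_within_open[OF _ assms(1) that] Suc.prems(1) by blast
  qed
  have "C_k_on m S (\<lambda>x. frechet_derivative g (at x) v)" for v
    using Suc.IH[of "\<lambda>x. frechet_derivative f (at x) v" "\<lambda>x. frechet_derivative g (at x) v"]
      Suc.prems(2) frechet_derivative_at[OF *] by simp
  then show ?case
    using * unfolding differentiable_def C_k_on.simps by blast
qed

text \<open>Uniqueness of the derivative allows an explicit candidate \<open>f'\<close> in place of
  \<open>frechet_derivative\<close>; every rule below is proved in this form.\<close>

lemma C_k_on_SucI: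
  assumes "open S" "\<And>x. x \<in> S \<Longrightarrow> (f has_derivative f' x) (at x)"
    and "\<And>v. C_k_on m S (\<lambda>x. f' x v)"
  shows "C_k_on (Suc m) S f"
proof -
  have "C_k_on m S (\<lambda>x. frechet_derivative f (at x) v)" for v
    using C_k_on_cong[OF assms(1) _ assms(3)] frechet_derivative_at[OF assms(2)] by fastforce
  then show ?thesis
    using assms(2) unfolding differentiable_def C_k_on.simps by blast
qed

lemma C_k_on_SucE:
  assumes "C_k_on (Suc m) S f"
  obtains f' where "\<And>x. x \<in> S \<Longrightarrow> (f has_derivative f' x) (at x)"
    "\<And>v. C_k_on m S (\<lambda>x. f' x v)"
  using assms that[of "\<lambda>x. frechet_derivative f (at x)"]
  by (simp add: frechet_derivative_works)

text \<open>Needed because product and chain rules leave some factors undifferentiated, and these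
  must be known one order lower.\<close>

lemma C_k_on_SucD: "C_k_on (Suc m) S f \<Longrightarrow> C_k_on m S f"
proof (induction m arbitrary: f)
  case 0
  then show ?case
    by (auto intro!: continuous_at_imp_continuous_on differentiable_imp_continuous_within)
next
  case (Suc m)
  then show ?case by simp
qed

lemma C_k_on_const: "open S \<Longrightarrow> C_k_on m S (\<lambda>x. c)"
proof (induction m arbitrary: c)
  case (Suc m)
  then show ?case
    by (intro C_k_on_SucI[where f' = "\<lambda>x v. 0"]) auto
qed simp

lemma C_k_on_add:
  assumes "open S" "C_k_on m S f" "C_k_on m S g"
  shows "C_k_on m S (\<lambda>x. f x + g x)"
  using assms(2,3)
proof (induction m arbitrary: f g)
  case 0
  then show ?case by (simp add: continuous_on_add)
next
  case (Suc m)
  obtain f' where f': "\<And>x. x \<in> S \<Longrightarrow> (f has_derivative f' x) (at x)"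
    "\<And>v. C_k_on m S (\<lambda>x. f' x v)" using Suc.prems(1) by (rule C_k_on_SucE) blast
  obtain g' where g': "\<And>x. x \<in> S \<Longrightarrow> (g has_derivative g' x) (at x)"
    "\<And>v. C_k_on m S (\<lambda>x. g' x v)" using Suc.prems(2) by (rule C_k_on_SucE) blast
  show ?case
    by (rule C_k_on_SucI[OF assms(1), where f' = "\<lambda>x v. f' x v + g' x v"])
      (auto intro: has_derivative_add f' g' Suc.IH)
qed

lemma C_k_on_sum:
  assumes "open S" "\<And>i. i \<in> I \<Longrightarrow> C_k_on m S (f i)"
  shows "C_k_on m S (\<lambda>x. \<Sum>i\<in>I. f i x)"
  using assms(2)
  by (induction I rule: infinite_finite_induct)
    (auto intro: C_k_on_const C_k_on_add assms(1))

text \<open>Leibniz rule, stated once for scaling, multiplication and inner products.\<close>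

lemma C_k_on_bounded_bilinear:
  assumes "bounded_bilinear h" "open S" "C_k_on m S f" "C_k_on m S g"
  shows "C_k_on m S (\<lambda>x. h (f x) (g x))"
  using assms(3,4)
proof (induction m arbitrary: f g)
  case 0
  then show ?case by (simp add: bounded_bilinear.continuous_on[OF assms(1)])
next
  case (Suc m)
  obtain f' where f': "\<And>x. x \<in> S \<Longrightarrow> (f has_derivative f' x) (at x)"
    "\<And>v. C_k_on m S (\<lambda>x. f' x v)" using Suc.prems(1) by (rule C_k_on_SucE) blast
  obtain g' where g': "\<And>x. x \<in> S \<Longrightarrow> (g has_derivative g' x) (at x)"
    "\<And>v. C_k_on m S (\<lambda>x. g' x v)" using Suc.prems(2) by (rule C_k_on_SucE) blast
  show ?case
    by (rule C_k_on_SucI[OF assms(2), where f' = "\<lambda>x v. h (f x) (g' x v) + h (f' x v) (g x)"])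
      (auto intro!: bounded_bilinear.FDERIV[OF assms(1)] f' g' Suc.IH C_k_on_add assms(2)
        C_k_on_SucD[OF Suc.prems(1)] C_k_on_SucD[OF Suc.prems(2)])
qed

lemmas C_k_on_scaleR = C_k_on_bounded_bilinear[OF bounded_bilinear_scaleR]
lemmas C_k_on_mult = C_k_on_bounded_bilinear[OF bounded_bilinear_mult]
lemmas C_k_on_inner = C_k_on_bounded_bilinear[OF bounded_bilinear_inner]

lemma C_k_on_prod:
  fixes f :: "'i \<Rightarrow> 'a::real_normed_vector \<Rightarrow> real"
  assumes "open S" "\<And>i. i \<in> I \<Longrightarrow> C_k_on m S (f i)"
  shows "C_k_on m S (\<lambda>x. \<Prod>i\<in>I. f i x)"
  using assms(2)
  by (induction I rule: infinite_finite_induct)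
    (auto intro: C_k_on_const C_k_on_mult assms(1))

text \<open>The derivative of \<open>1/f\<close> is a product of \<open>f'\<close> with two copies
  of \<open>1/f\<close>, and the latter are covered by the induction hypothesis.\<close>

lemma C_k_on_inverse:
  fixes f :: "'a::real_normed_vector \<Rightarrow> real"
  assumes "open S" "C_k_on m S f" "\<And>x. x \<in> S \<Longrightarrow> f x \<noteq> 0"
  shows "C_k_on m S (\<lambda>x. inverse (f x))"
  using assms(2)
proof (induction m)
  case 0
  then show ?case using assms(3) by (simp add: continuous_on_inverse)
next
  case (Suc m)
  obtain f' where f': "\<And>x. x \<in> S \<Longrightarrow> (f has_derivative f' x) (at x)"
    "\<And>v. C_k_on m S (\<lambda>x. f' x v)" using Suc.prems by (rule C_k_on_SucE) blast
  have inv: "C_k_on m S (\<lambda>x. inverse (f x))"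
    using Suc.IH C_k_on_SucD[OF Suc.prems] by blast
  show ?case
  proof (rule C_k_on_SucI[OF assms(1)])
    show "((\<lambda>x. inverse (f x)) has_derivative (\<lambda>v. - (inverse (f x) * f' x v * inverse (f x)))) (at x)"
      if "x \<in> S" for x
      using that assms(3) f'(1) by (intro Deriv.has_derivative_inverse)
    \<comment> \<open>The sign is written as a constant factor so that the product rule covers
      it.\<close>
    have "C_k_on m S (\<lambda>x. - 1 * (inverse (f x) * f' x v * inverse (f x)))" for v
      by (intro C_k_on_mult[OF assms(1)] C_k_on_const[OF assms(1)] inv f')
    then show "C_k_on m S (\<lambda>x. - (inverse (f x) * f' x v * inverse (f x)))" for v
      by simp
  qed
qed

lemma C_k_on_vec_nth: "open S \<Longrightarrow> C_k_on m S f \<Longrightarrow> C_k_on m S (\<lambda>x. f x $ i :: real)"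
  using C_k_on_inner[of S m f "\<lambda>x. axis i 1"] by (simp add: C_k_on_const inner_axis)

lemma C_k_on_vec_lambda:
  fixes f :: "'i::finite \<Rightarrow> 'a::real_normed_vector \<Rightarrow> real"
  assumes "open S" "\<And>i. C_k_on m S (f i)"
  shows "C_k_on m S (\<lambda>x. \<chi> i. f i x)"
proof -
  have "(\<chi> i. f i x) = (\<Sum>i\<in>UNIV. f i x *\<^sub>R axis i 1)" for x
    by (simp add: vec_eq_iff axis_def if_distrib cong: if_cong)
  then show ?thesis
    using assms by (auto intro!: C_k_on_sum C_k_on_scaleR C_k_on_const)
qed

text \<open>The Leibniz formula makes the determinant a polynomial in the entries.\<close>

lemma C_k_on_det:
  fixes A :: "'a::real_normed_vector \<Rightarrow> real ^ 'n ^ 'n"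
  assumes "open S" "\<And>i j. C_k_on m S (\<lambda>x. A x $ i $ j)"
  shows "C_k_on m S (\<lambda>x. det (A x))"
  unfolding det_def
  by (rule C_k_on_sum[OF assms(1)], rule C_k_on_mult[OF assms(1)], rule C_k_on_const[OF assms(1)],
      rule C_k_on_prod[OF assms(1)], rule assms(2))

text \<open>The chain rule evaluates \<open>f'\<close> in the direction \<open>g' x v\<close>, which
  varies with \<open>x\<close>, whereas \<open>C_k_on\<close> controls fixed directions only.
  Expanding along \<open>Basis\<close> separates the two dependences; the induction hypothesis then
  applies to \<open>f'\<close> in each basis direction, with \<open>g\<close> unchanged.\<close>

lemma C_k_on_compose:
  fixes f :: "'b::euclidean_space \<Rightarrow> 'c::real_normed_vector"
  assumes "open S" "open T" "g ` S \<subseteq> T" "C_k_on m S g" "C_k_on m T f"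
  shows "C_k_on m S (\<lambda>x. f (g x))"
  using assms(4,5)
proof (induction m arbitrary: f)
  case 0
  then show ?case using assms(3) by (simp add: continuous_on_compose2)
next
  case (Suc m)
  obtain f' where f': "\<And>x. x \<in> T \<Longrightarrow> (f has_derivative f' x) (at x)"
    "\<And>v. C_k_on m T (\<lambda>x. f' x v)" using Suc.prems(2) by (rule C_k_on_SucE) blast
  obtain g' where g': "\<And>x. x \<in> S \<Longrightarrow> (g has_derivative g' x) (at x)"
    "\<And>v. C_k_on m S (\<lambda>x. g' x v)" using Suc.prems(1) by (rule C_k_on_SucE) blast
  have g: "C_k_on m S g" using C_k_on_SucD Suc.prems(1) by blast
  show ?case
  proof (rule C_k_on_SucI[OF assms(1), where f' = "\<lambda>x v. \<Sum>b\<in>Basis. (g' x v \<bullet> b) *\<^sub>R f' (g x) b"])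
    fix x assume x: "x \<in> S"
    then have fx: "(f has_derivative f' (g x)) (at (g x))" using f'(1) assms(3) by blast
    have *: "f' (g x) w = (\<Sum>b\<in>Basis. (w \<bullet> b) *\<^sub>R f' (g x) b)" for w
      using linear_sum[OF has_derivative_linear[OF fx], of "\<lambda>b. (w \<bullet> b) *\<^sub>R b" Basis]
        linear_scale[OF has_derivative_linear[OF fx]]
      by (simp add: euclidean_representation)
    then show "((\<lambda>x. f (g x)) has_derivative (\<lambda>v. \<Sum>b\<in>Basis. (g' x v \<bullet> b) *\<^sub>R f' (g x) b)) (at x)"
      using has_derivative_compose[OF g'(1)[OF x] fx] by (simp flip: *)
  next
    show "C_k_on m S (\<lambda>x. \<Sum>b\<in>Basis. (g' x v \<bullet> b) *\<^sub>R f' (g x) b)" for v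
      by (rule C_k_on_sum[OF assms(1)], rule C_k_on_scaleR[OF assms(1)],
          rule C_k_on_inner[OF assms(1)], rule g', rule C_k_on_const[OF assms(1)],
          rule Suc.IH[OF g f'(2)])
  qed
qed

section \<open>Injective smooth maps with invertible derivative\<close>

text \<open>Invariance of domain makes the image open and the inverse \<open>g\<close> continuous.
  Since \<open>Dg(y) v = B v (g y)\<close> with \<open>B v\<close> smooth, regularity bootstraps: if
  \<open>g\<close> is of order \<open>m\<close>, so is its derivative, hence \<open>g\<close> is of
  order \<open>m + 1\<close>.\<close>

lemma diffeomorphism_between_image:
  fixes f :: "real ^ 'n \<Rightarrow> real ^ 'n"
  assumes "open S" "inj_on f S" "smooth_on S f"
    and ker: "\<And>x v. x \<in> S \<Longrightarrow> frechet_derivative f (at x) v = 0 \<Longrightarrow> v = 0"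
  shows "diffeomorphism_between S (f ` S) f"
proof -
  have "C_k_on m S f" for m
    using assms(3) by (simp add: smooth_on_def)
  then have C0: "C_k_on 0 S f" and CS: "C_k_on (Suc m) S f" for m by blast+
  have cont: "continuous_on S f" using C0 by simp
  define A where "A x = matrix (frechet_derivative f (at x))" for x
  define g where "g = inv_into S f"
  have gf: "g (f x) = x" if "x \<in> S" for x
    using assms(2) that by (simp add: g_def)
  have op: "open (f ` S)"
    using invariance_of_domain[OF cont assms(1,2)] .
  have A: "(f has_derivative (*v) (A x)) (at x)" if "x \<in> S" for x
  proof -
    have *: "(f has_derivative frechet_derivative f (at x)) (at x)"
      using CS[of 0] that by (simp flip: frechet_derivative_works)
    have "(*v) (A x) = frechet_derivative f (at x)"
      unfolding A_def using has_derivative_linear[OF *]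
      by (intro ext matrix_works) (simp add: linear_matrix_vector_mul_eq)
    then show ?thesis using * by simp
  qed
  have nz: "det (A x) \<noteq> 0" if "x \<in> S" for x
  proof -
    have "v = 0" if "A x *v v = 0" for v
      using ker[OF \<open>x \<in> S\<close>, of v] that frechet_derivative_at[OF A[OF \<open>x \<in> S\<close>]] by metis
    then show ?thesis
      by (meson invertible_det_nz invertible_left_inverse matrix_left_invertible_ker)
  qed
  have CA: "C_k_on m S (\<lambda>x. A x $ i $ j)" for m i j
  proof -
    have "C_k_on m S (\<lambda>x. frechet_derivative f (at x) (axis j 1) $ i)"
      using CS[of m] by (intro C_k_on_vec_nth[OF assms(1)]) simp
    then show ?thesis by (simp add: A_def matrix_def)
  qed
  \<comment> \<open>the inverse of the Jacobian through Cramer's rule, which makes its smoothness visible\<close>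
  define B where
    "B v x = (\<chi> k. det (\<chi> i j. if j = k then v $ i else A x $ i $ j) * inverse (det (A x)))" for v x
  have AB: "A x *v B v x = v" if "x \<in> S" for x v
    using cramer[OF nz[OF that], of "B v x" v] by (simp add: B_def divide_inverse)
  have CB: "C_k_on m S (B v)" for m v
    unfolding B_def
  proof (intro C_k_on_vec_lambda C_k_on_mult C_k_on_inverse C_k_on_det assms(1) CA nz)
    show "C_k_on m S (\<lambda>x. (\<chi> i j. if j = k then v $ i else A x $ i $ j) $ i $ j)" for k i j
      using CA C_k_on_const[OF assms(1)] by (cases "j = k") auto
  qed
  have dg: "(g has_derivative (\<lambda>v. B v (g y))) (at y)" if y: "y \<in> f ` S" for y
  proof -
    obtain x where x: "x \<in> S" "y = f x" using y by blast
    \<comment> \<open>A right inverse of the derivative suffices, the dimensions being equal and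
      finite.\<close>
    have "(*v) (A x) \<circ> (\<lambda>v. B v x) = id"
      using AB[OF x(1)] by auto
    then show ?thesis
      using has_derivative_inverse_on[OF assms(1) A gf, of x "\<lambda>x v. B v x"] x gf by auto
  qed
  have "C_k_on m (f ` S) g" for m
  proof (induction m)
    case 0
    then show ?case
      using continuous_on_inverse_open[OF assms(1) cont _ gf] by simp
  next
    case (Suc m)
    show ?case
    proof (rule C_k_on_SucI[OF op dg])
      show "C_k_on m (f ` S) (\<lambda>y. B v (g y))" for v
        using C_k_on_compose[OF op assms(1) _ Suc CB] gf by (simp add: image_subset_iff)
    qed
  qed
  then show ?thesis
    unfolding diffeomorphism_between_def smooth_on_def
    using assms op inj_on_imp_bij_betw by (auto simp: g_def smooth_on_def)
qed

subsection \<open>Integrals over a compact set\<close>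

lemma set_integrable_continuous_compact:
  fixes f :: "'a::euclidean_space \<Rightarrow> 'b::{banach, second_countable_topology}"
  shows "compact K \<Longrightarrow> continuous_on K f \<Longrightarrow> set_integrable lborel K f"
  unfolding set_integrable_def by (rule borel_integrable_compact)

text \<open>Differentiation under the integral sign, with \<open>\<phi>\<close> as the gradient in
  \<open>q\<close>. Joint continuity becomes uniform continuity on a closed ball times
  \<open>K\<close>, so the linearization error is small relative to \<open>norm (y - q0)\<close>
  uniformly in \<open>x\<close>, and this bound can be integrated.\<close>

lemma has_derivative_integral_compact:
  fixes g :: "'b::euclidean_space \<Rightarrow> 'a::euclidean_space \<Rightarrow> real"
  assumes "open U" "compact K" "q0 \<in> U"
    and g: "\<And>q x. q \<in> U \<Longrightarrow> x \<in> K \<Longrightarrow> ((\<lambda>q. g q x) has_derivative (\<lambda>v. \<phi> q x \<bullet> v)) (at q)"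
    and cont_g: "\<And>q. q \<in> U \<Longrightarrow> continuous_on K (g q)"
    and cont: "continuous_on (U \<times> K) (\<lambda>(q, x). \<phi> q x)"
  shows "((\<lambda>q. LINT x:K|lborel. g q x) has_derivative (\<lambda>v. LINT x:K|lborel. \<phi> q0 x \<bullet> v)) (at q0)"
  unfolding has_derivative_at_alt
proof (intro conjI allI impI)
  have "continuous_on K (\<lambda>x. \<phi> q0 x)"
    using continuous_on_compose2[OF cont continuous_on_Pair[OF continuous_on_const continuous_on_id]]
      assms(3) by auto
  then have int\<phi>: "set_integrable lborel K (\<lambda>x. \<phi> q0 x \<bullet> v)" for v
    by (intro set_integrable_continuous_compact assms(2) continuous_intros)
  show "bounded_linear (\<lambda>v. LINT x:K|lborel. \<phi> q0 x \<bullet> v)"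
    unfolding linear_conv_bounded_linear[symmetric]
    by (rule linearI) (simp_all add: inner_add_right int\<phi>)
  fix e :: real assume e: "e > 0"
  define \<mu> where "\<mu> = measure lborel K"
  \<comment> \<open>Adding 1 keeps the denominator positive even if \<open>K\<close> is a null
    set.\<close>
  define e' where "e' = e / (\<mu> + 1)"
  have \<mu>: "\<mu> \<ge> 0" by (simp add: \<mu>_def)
  then have e': "e' > 0" "e' * \<mu> \<le> e" using e by (auto simp: e'_def field_simps)
  obtain r where r: "r > 0" "cball q0 r \<subseteq> U"
    using assms(1,3) open_contains_cball by blast
  have "uniformly_continuous_on (cball q0 r \<times> K) (\<lambda>(q, x). \<phi> q x)"
    using r by (intro compact_uniformly_continuous compact_Times assms(2) compact_cball
        continuous_on_subset[OF cont]) auto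
  then obtain d where d: "d > 0" and
    unif: "\<And>z z'. z \<in> cball q0 r \<times> K \<Longrightarrow> z' \<in> cball q0 r \<times> K \<Longrightarrow> dist z' z < d \<Longrightarrow>
      dist ((\<lambda>(q, x). \<phi> q x) z') ((\<lambda>(q, x). \<phi> q x) z) < e'"
    unfolding uniformly_continuous_on_def using e'(1) by blast
  show "\<exists>d>0. \<forall>y. norm (y - q0) < d \<longrightarrow>
      norm ((LINT x:K|lborel. g y x) - (LINT x:K|lborel. g q0 x) - (LINT x:K|lborel. \<phi> q0 x \<bullet> (y - q0)))
      \<le> e * norm (y - q0)"
  proof (intro exI conjI allI impI)
    show "min r d > 0" using r d by simp
    fix y assume y: "norm (y - q0) < min r d"
    then have yU: "y \<in> U" using r(2) by (auto simp: dist_norm norm_minus_commute subset_iff)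
    let ?h = "\<lambda>x. g y x - g q0 x - \<phi> q0 x \<bullet> (y - q0)"
    \<comment> \<open>Mean value inequality for \<open>g\<close> minus its linear part at
      \<open>q0\<close>: the derivative of the difference has norm at most \<open>e'\<close> on the
      ball.\<close>
    have bound: "norm (?h x) \<le> norm (y - q0) * e'" if x: "x \<in> K" for x
    proof (rule differentiable_bound_linearization[where S = "ball q0 (min r d)"
          and f' = "\<lambda>q v. \<phi> q x \<bullet> v"])
      show "q0 + t *\<^sub>R (y - q0) \<in> ball q0 (min r d)" if t: "t \<in> {0..1}" for t
      proof -
        have "t * norm (y - q0) \<le> norm (y - q0)"
          using t by (simp add: mult_left_le_one_le)
        then show ?thesis using y t by (simp add: dist_norm)
      qed
      show "((\<lambda>q. g q x) has_derivative (\<lambda>v. \<phi> q x \<bullet> v)) (at q within ball q0 (min r d))"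
        if "q \<in> ball q0 (min r d)" for q
        using that r(2) by (intro has_derivative_at_withinI[OF g[OF _ x]]) auto
      show "onorm ((\<lambda>v. \<phi> q x \<bullet> v) - (\<lambda>v. \<phi> q0 x \<bullet> v)) \<le> e'" if q: "q \<in> ball q0 (min r d)" for q
      proof (rule onorm_bound)
        have "norm (\<phi> q x - \<phi> q0 x) < e'"
          using unif[of "(q0, x)" "(q, x)"] q x r(1) by (auto simp: dist_Pair_Pair dist_norm norm_minus_commute)
        then have *: "norm (\<phi> q x - \<phi> q0 x) * norm v \<le> e' * norm v" for v
          by (intro mult_right_mono) auto
        then show "norm (((\<lambda>v. \<phi> q x \<bullet> v) - (\<lambda>v. \<phi> q0 x \<bullet> v)) v) \<le> e' * norm v" for v
          using order_trans[OF Cauchy_Schwarz_ineq2 *] by (simp add: inner_diff_left)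
      qed (use e' in auto)
      show "q0 \<in> ball q0 (min r d)" using r d by simp
    qed
    have ig: "set_integrable lborel K (g y)" "set_integrable lborel K (g q0)"
      using cont_g yU assms(2,3) by (auto intro: set_integrable_continuous_compact)
    then have ih: "set_integrable lborel K ?h"
      using int\<phi> by (intro set_integral_diff)
    have "(LINT x:K|lborel. g y x) - (LINT x:K|lborel. g q0 x) - (LINT x:K|lborel. \<phi> q0 x \<bullet> (y - q0))
      = (LINT x:K|lborel. ?h x)"
      by (simp add: ig int\<phi>)
    also have "norm \<dots> \<le> (LINT x:K|lborel. norm (?h x))"
      by (rule set_integral_norm_bound[OF ih])
    also have "\<dots> \<le> (LINT x:K|lborel. norm (y - q0) * e')"
      by (intro set_integral_mono set_integrable_norm ih bound set_integrable_continuous_compact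
          assms(2) continuous_intros)
    also have "\<dots> = norm (y - q0) * (e' * \<mu>)"
      using borel_compact[OF assms(2)] emeasure_compact_finite[OF assms(2)]
      by (simp add: \<mu>_def set_lebesgue_integral_def)
    also have "\<dots> \<le> e * norm (y - q0)"
      using mult_left_mono[OF e'(2), of "norm (y - q0)"] by (simp add: mult.commute)
    finally show "norm ((LINT x:K|lborel. g y x) - (LINT x:K|lborel. g q0 x)
      - (LINT x:K|lborel. \<phi> q0 x \<bullet> (y - q0))) \<le> e * norm (y - q0)" .
  qed
qed

text \<open>If the integral vanished, \<open>h\<close> would be zero almost everywhere on
  \<open>K\<close>. The part of the interior where \<open>h\<close> is nonzero is then open and
  null, hence empty, and continuity carries \<open>h = 0\<close> from the interior to its closure,
  which contains \<open>x0\<close>.\<close>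

lemma set_integral_pos_compact:
  fixes h :: "'a::euclidean_space \<Rightarrow> real"
  assumes "compact K" "K \<subseteq> closure (interior K)" "continuous_on K h"
    and "\<And>x. x \<in> K \<Longrightarrow> h x \<ge> 0" "x0 \<in> K" "h x0 \<noteq> 0"
  shows "(LINT x:K|lborel. h x) > 0"
proof (rule ccontr)
  let ?f = "\<lambda>x. indicator K x *\<^sub>R h x"
  have int: "integrable lborel ?f"
    using assms by (intro borel_integrable_compact)
  have "integral\<^sup>L lborel ?f \<ge> 0"
    using assms(4) by (intro Bochner_Integration.integral_nonneg) (simp add: indicator_def)
  moreover assume "\<not> (LINT x:K|lborel. h x) > 0"
  ultimately have "integral\<^sup>L lborel ?f = 0"
    by (simp add: set_lebesgue_integral_def)
  then have ae: "AE x in lborel. ?f x = 0"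
    using assms(4) int by (subst (asm) integral_nonneg_eq_0_iff_AE) (auto simp: indicator_def)
  define V where "V = interior K \<inter> h -` (- {0})"
  have contI: "continuous_on (interior K) h"
    using assms(3) continuous_on_subset interior_subset by blast
  have "open V"
    unfolding V_def by (rule continuous_open_preimage[OF contI]) auto
  moreover have "negligible V"
  proof -
    have "AE x in lborel. x \<notin> V"
      using ae by eventually_elim (use interior_subset in \<open>auto simp: V_def indicator_def\<close>)
    moreover have "{x \<in> space lborel. \<not> x \<notin> V} = V" by simp
    moreover have "V \<in> sets lborel" using \<open>open V\<close> by simp
    ultimately have "V \<in> null_sets lborel"
      using AE_iff_null_sets by blast
    then show ?thesis
      by (simp add: negligible_iff_null_sets null_sets_completionI)
  qed
  ultimately have "V = {}" using open_not_negligible by blast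
  then have "\<And>x. x \<in> interior K \<Longrightarrow> h x = 0" by (auto simp: V_def)
  moreover have "x0 \<in> closure (interior K)" using assms by blast
  moreover have "closure (interior K) \<subseteq> K"
    using assms(1) by (simp add: closure_minimal compact_imp_closed interior_subset)
  ultimately have "h x0 = 0"
    using continuous_constant_on_closure[of "interior K" h 0 x0] continuous_on_subset[OF assms(3)] by blast
  then show False using assms by blast
qed

subsection \<open>The moment map\<close>

lemma lin_comb_eq_inner: "lin_comb \<alpha> q x = q \<bullet> (\<chi> k. \<alpha> k x)"
  by (simp add: lin_comb_def inner_vec_def)

lemma lin_comb_diff: "lin_comb \<alpha> (q - r) x = lin_comb \<alpha> q x - lin_comb \<alpha> r x"
  by (simp add: lin_comb_eq_inner inner_diff_left)

lemma scaleR_closure_pos_cone: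
  assumes "c > 0" "r \<in> closure (pos_cone K \<alpha>)"
  shows "c *\<^sub>R r \<in> closure (pos_cone K \<alpha>)"
proof -
  have "(*\<^sub>R) c ` pos_cone K \<alpha> \<subseteq> pos_cone K \<alpha>"
    using assms(1) by (auto simp: pos_cone_def lin_comb_eq_inner)
  then have "(*\<^sub>R) c ` closure (pos_cone K \<alpha>) \<subseteq> closure (pos_cone K \<alpha>)"
    by (simp add: closure_scaleR closure_mono)
  then show ?thesis using assms(2) by blast
qed

text \<open>An intersection of half-spaces; convexity later supplies connectedness.\<close>

lemma convex_dual_cone: "convex (dual_cone K \<alpha>)"
proof -
  have "dual_cone K \<alpha> = (\<Inter>r \<in> closure (pos_cone K \<alpha>) - {0}. {c. r \<bullet> c > 0})"
    by (auto simp: dual_cone_def inner_commute)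
  then show ?thesis by (simp add: convex_INT convex_halfspace_gt)
qed

text \<open>The continuous form \<open>c \<bullet> r\<close> attains a positive minimum on the
  compact set of unit vectors of the closed cone, and homogeneity extends the bound to all of
  it.\<close>

lemma dual_cone_margin:
  fixes \<alpha> :: "'n::finite \<Rightarrow> 'a \<Rightarrow> real"
  assumes "c \<in> dual_cone K \<alpha>"
  obtains \<epsilon> where "\<epsilon> > 0" "\<And>r. r \<in> closure (pos_cone K \<alpha>) \<Longrightarrow> \<epsilon> * norm r \<le> c \<bullet> r"
proof -
  define D where "D = closure (pos_cone K \<alpha>) \<inter> sphere 0 1"
  have "\<exists>\<epsilon>>0. \<forall>r\<in>D. \<epsilon> \<le> c \<bullet> r"
  \<comment> \<open>If the closed cone has no unit vector, any margin works.\<close>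
  proof (cases "D = {}")
    case True
    then show ?thesis using zero_less_one by blast
  next
    case False
    have "compact D" unfolding D_def by (simp add: closed_Int_compact)
    moreover have "continuous_on D (\<lambda>r. c \<bullet> r)" by (intro continuous_intros)
    ultimately obtain r where "r \<in> D" "\<And>s. s \<in> D \<Longrightarrow> c \<bullet> r \<le> c \<bullet> s"
      using continuous_attains_inf[OF _ False] by blast
    moreover from this have "c \<bullet> r > 0"
      using assms by (auto simp: dual_cone_def D_def)
    ultimately show ?thesis by blast
  qed
  then obtain \<epsilon> where \<epsilon>: "\<epsilon> > 0" "\<And>r. r \<in> D \<Longrightarrow> \<epsilon> \<le> c \<bullet> r" by blast
  have "\<epsilon> * norm r \<le> c \<bullet> r" if "r \<in> closure (pos_cone K \<alpha>)" for r
  proof (cases "r = 0")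
    case False
    then have "(1 / norm r) *\<^sub>R r \<in> D"
      using scaleR_closure_pos_cone[OF _ that, of "1 / norm r"] by (simp add: D_def)
    then have "\<epsilon> \<le> c \<bullet> ((1 / norm r) *\<^sub>R r)" using \<epsilon>(2) by blast
    then show ?thesis using False by (simp add: field_simps)
  qed simp
  then show ?thesis using that \<epsilon>(1) by blast
qed

text \<open>Standing data without a chosen \<open>p\<close>. \<open>K_subset\<close> serves strict
  positivity of integrals, \<open>nonempty_K\<close> the attainment of minima, and
  \<open>indep\<close> makes a nonzero coefficient vector visible at some point of
  \<open>K\<close>.\<close>

locale positive_cone =
  fixes K :: "(real ^ 'd) set" and \<alpha> :: "'n::finite \<Rightarrow> real ^ 'd \<Rightarrow> real"
  assumes compact_K: "compact K"
    and K_subset: "K \<subseteq> closure (interior K)"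
    and nonempty_K: "K \<noteq> {}"
    and continuous_\<alpha>: "\<And>k. continuous_on K (\<alpha> k)"
    and indep: "lin_indep_on K \<alpha>"
begin

lemma continuous_lin_comb: "continuous_on K (lin_comb \<alpha> q)"
  unfolding lin_comb_def[abs_def] by (intro continuous_intros continuous_\<alpha>)

lemma pos_coneD: "q \<in> pos_cone K \<alpha> \<Longrightarrow> x \<in> K \<Longrightarrow> lin_comb \<alpha> q x > 0"
  by (simp add: pos_cone_def)

lemma pos_cone_lower_bound:
  assumes "q \<in> pos_cone K \<alpha>"
  obtains m where "m > 0" "\<And>x. x \<in> K \<Longrightarrow> m \<le> lin_comb \<alpha> q x"
  using continuous_attains_inf[OF compact_K nonempty_K continuous_lin_comb, of q] pos_coneD[OF assms]
    that by blast

lemma lin_comb_nonzero: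
  assumes "r \<noteq> 0"
  obtains x where "x \<in> K" "lin_comb \<alpha> r x \<noteq> 0"
  using assms indep by (auto simp: lin_indep_on_def)

text \<open>With \<open>m\<close> a positive lower bound of \<open>Q\<close> and \<open>B\<close> a
  bound on the vector of all \<open>\<alpha> k x\<close>, moving \<open>q\<close> by less than
  \<open>m / B\<close> changes \<open>Q\<close> by less than \<open>m\<close>.\<close>

lemma open_pos_cone: "open (pos_cone K \<alpha>)"
proof (rule openI)
  fix q assume "q \<in> pos_cone K \<alpha>"
  then obtain m where m: "m > 0" "\<And>x. x \<in> K \<Longrightarrow> m \<le> lin_comb \<alpha> q x"
    using pos_cone_lower_bound by blast
  have "continuous_on K (\<lambda>x. \<chi> k. \<alpha> k x)"
    by (intro continuous_on_vec_lambda continuous_\<alpha>)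
  then have "bounded ((\<lambda>x. \<chi> k. \<alpha> k x) ` K)"
    using compact_K compact_continuous_image compact_imp_bounded by blast
  then obtain B where B: "B > 0" "\<And>x. x \<in> K \<Longrightarrow> norm (\<chi> k. \<alpha> k x) \<le> B"
    unfolding bounded_pos by blast
  have "r \<in> pos_cone K \<alpha>" if "r \<in> ball q (m / B)" for r
    unfolding pos_cone_def
  proof safe
    fix x assume x: "x \<in> K"
    have "lin_comb \<alpha> q x - lin_comb \<alpha> r x \<le> norm (q - r) * norm (\<chi> k. \<alpha> k x)"
      unfolding lin_comb_diff[symmetric] unfolding lin_comb_eq_inner
      by (rule norm_cauchy_schwarz)
    also have "\<dots> \<le> norm (q - r) * B"
      by (intro mult_left_mono B x) simp
    also have "\<dots> < m"
      using that B(1) by (simp add: dist_norm field_simps)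
    finally show "lin_comb \<alpha> r x > 0" using m(2)[OF x] by linarith
  qed
  then show "\<exists>e>0. ball q e \<subseteq> pos_cone K \<alpha>"
    using m(1) B(1) by (intro exI[of _ "m / B"]) auto
qed

section \<open>Values of the moment map and injectivity\<close>

lemma continuous_quotient:
  assumes "q \<in> pos_cone K \<alpha>" "continuous_on K h"
  shows "continuous_on K (\<lambda>x. h x / lin_comb \<alpha> q x)"
  using pos_coneD[OF assms(1)]
  by (intro continuous_on_divide assms(2) continuous_lin_comb) (metis less_irrefl)

text \<open>Linearity of the integral in \<open>r\<close>. All positivity arguments about the
  vector-valued map pass through this scalar formula.\<close>

lemma inner_moment_map:
  assumes "q \<in> pos_cone K \<alpha>"
  shows "r \<bullet> moment_map K \<alpha> p q
    = (LINT x:K|lborel. lin_comb \<alpha> r x * (lin_comb \<alpha> p x / lin_comb \<alpha> q x))"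
proof -
  have int: "set_integrable lborel K (\<lambda>x. r $ k * (\<alpha> k x * (lin_comb \<alpha> p x / lin_comb \<alpha> q x)))" for k
    by (intro set_integrable_continuous_compact compact_K continuous_intros continuous_\<alpha>
        continuous_quotient assms continuous_lin_comb)
  have "(LINT x:K|lborel. lin_comb \<alpha> r x * (lin_comb \<alpha> p x / lin_comb \<alpha> q x))
    = (LINT x:K|lborel. \<Sum>k\<in>UNIV. r $ k * (\<alpha> k x * (lin_comb \<alpha> p x / lin_comb \<alpha> q x)))"
    by (simp add: lin_comb_def[of _ r] sum_distrib_right sum_divide_distrib mult.assoc)
  also have "\<dots> = (\<Sum>k\<in>UNIV. LINT x:K|lborel. r $ k * (\<alpha> k x * (lin_comb \<alpha> p x / lin_comb \<alpha> q x)))"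
    using int unfolding set_lebesgue_integral_def set_integrable_def scaleR_sum_right
    by (intro Bochner_Integration.integral_sum) auto
  also have "\<dots> = r \<bullet> moment_map K \<alpha> p q"
    by (simp only: inner_vec_def moment_map_def vec_lambda_beta set_integral_mult_right inner_real_def)
  finally show ?thesis by simp
qed

text \<open>The integrand \<open>R P / Q\<close> is nonnegative for \<open>r\<close> in the closed
  cone, and linear independence makes it nonzero somewhere.\<close>

lemma moment_map_in_dual_cone:
  assumes "p \<in> pos_cone K \<alpha>" "q \<in> pos_cone K \<alpha>"
  shows "moment_map K \<alpha> p q \<in> dual_cone K \<alpha>"
  unfolding dual_cone_def
proof (intro CollectI ballI)
  fix r assume "r \<in> closure (pos_cone K \<alpha>) - {0}"
  then have r: "r \<in> closure (pos_cone K \<alpha>)" "r \<noteq> 0" by auto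
  obtain x where x: "x \<in> K" "lin_comb \<alpha> r x \<noteq> 0" using lin_comb_nonzero[OF r(2)] by blast
  have "(LINT x:K|lborel. lin_comb \<alpha> r x * (lin_comb \<alpha> p x / lin_comb \<alpha> q x)) > 0"
  proof (rule set_integral_pos_compact[OF compact_K K_subset _ _ x(1)])
    show "continuous_on K (\<lambda>x. lin_comb \<alpha> r x * (lin_comb \<alpha> p x / lin_comb \<alpha> q x))"
      by (intro continuous_on_mult continuous_lin_comb continuous_quotient assms)
    show "0 \<le> lin_comb \<alpha> r x * (lin_comb \<alpha> p x / lin_comb \<alpha> q x)" if "x \<in> K" for x
      using pos_cone_boundary_nonneg[OF r(1) that] pos_coneD[OF assms(1) that] pos_coneD[OF assms(2) that]
      by simp
    show "lin_comb \<alpha> r x * (lin_comb \<alpha> p x / lin_comb \<alpha> q x) \<noteq> 0"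
      using x pos_coneD[OF assms(1) x(1)] pos_coneD[OF assms(2) x(1)] by simp
  qed
  then show "moment_map K \<alpha> p q \<bullet> r > 0"
    by (simp add: inner_moment_map[OF assms(2)] inner_commute[of _ r])
qed

lemma inj_on_moment_map:
  assumes "p \<in> pos_cone K \<alpha>"
  shows "inj_on (moment_map K \<alpha> p) (pos_cone K \<alpha>)"
proof (rule inj_onI, rule ccontr)
  fix q r assume q: "q \<in> pos_cone K \<alpha>" and r: "r \<in> pos_cone K \<alpha>"
    and eq: "moment_map K \<alpha> p q = moment_map K \<alpha> p r" and "q \<noteq> r"
  then obtain x0 where x0: "x0 \<in> K" "lin_comb \<alpha> (q - r) x0 \<noteq> 0"
    using lin_comb_nonzero[of "q - r"] by auto
  let ?P = "lin_comb \<alpha> p" and ?Q = "lin_comb \<alpha> q" and ?R = "lin_comb \<alpha> r" and ?D = "lin_comb \<alpha> (q - r)"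
  \<comment> \<open>The left side is what splits into two pairings with \<open>q - r\<close>; the
    right side shows its sign.\<close>
  have id: "?D x * (?P x / ?R x) - ?D x * (?P x / ?Q x) = (?D x)\<^sup>2 * (?P x / ?Q x / ?R x)" if "x \<in> K" for x
    using pos_coneD[OF q that] pos_coneD[OF r that]
    by (simp add: lin_comb_diff field_simps power2_eq_square)
  have cont: "continuous_on K (\<lambda>x. ?D x * (?P x / ?R x))" "continuous_on K (\<lambda>x. ?D x * (?P x / ?Q x))"
    by (intro continuous_on_mult continuous_lin_comb continuous_quotient q r)+
  have "(LINT x:K|lborel. ?D x * (?P x / ?R x) - ?D x * (?P x / ?Q x)) > 0"
  proof (rule set_integral_pos_compact[OF compact_K K_subset _ _ x0(1)])
    show "continuous_on K (\<lambda>x. ?D x * (?P x / ?R x) - ?D x * (?P x / ?Q x))"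
      by (intro continuous_on_diff cont)
    show "0 \<le> ?D x * (?P x / ?R x) - ?D x * (?P x / ?Q x)" if "x \<in> K" for x
      unfolding id[OF that] using pos_coneD[OF q that] pos_coneD[OF r that] pos_coneD[OF assms that]
      by simp
    show "?D x0 * (?P x0 / ?R x0) - ?D x0 * (?P x0 / ?Q x0) \<noteq> 0"
      unfolding id[OF x0(1)]
      using pos_coneD[OF q x0(1)] pos_coneD[OF r x0(1)] pos_coneD[OF assms x0(1)] x0(2) by simp
  qed
  also have "(LINT x:K|lborel. ?D x * (?P x / ?R x) - ?D x * (?P x / ?Q x))
    = (LINT x:K|lborel. ?D x * (?P x / ?R x)) - (LINT x:K|lborel. ?D x * (?P x / ?Q x))"
    by (intro set_integral_diff set_integrable_continuous_compact compact_K cont)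
  also have "\<dots> = (q - r) \<bullet> moment_map K \<alpha> p r - (q - r) \<bullet> moment_map K \<alpha> p q"
    by (simp only: inner_moment_map q r)
  finally show False using eq by simp
qed

section \<open>Smoothness and the derivative of the moment map\<close>

text \<open>Integrals of \<open>h / Q^(j+1)\<close> with continuous weight \<open>h\<close> form a
  family closed under directional derivatives: the exponent rises by one and the weight is
  multiplied by \<open>-(j+1) V\<close>.\<close>

lemma has_derivative_recip_power_integral:
  assumes "continuous_on K h" "q \<in> pos_cone K \<alpha>"
  shows "((\<lambda>q. LINT x:K|lborel. h x * inverse (lin_comb \<alpha> q x) ^ Suc j) has_derivative
    (\<lambda>v. LINT x:K|lborel. - real (Suc j) * h x * lin_comb \<alpha> v x * inverse (lin_comb \<alpha> q x) ^ Suc (Suc j))) (at q)"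
proof -
  let ?a = "\<lambda>x. \<chi> k. \<alpha> k x"
  let ?\<phi> = "\<lambda>q x. (- real (Suc j) * h x * inverse (lin_comb \<alpha> q x) ^ Suc (Suc j)) *\<^sub>R ?a x"
  have "((\<lambda>q. LINT x:K|lborel. h x * inverse (lin_comb \<alpha> q x) ^ Suc j) has_derivative
    (\<lambda>v. LINT x:K|lborel. ?\<phi> q x \<bullet> v)) (at q)"
  proof (rule has_derivative_integral_compact[OF open_pos_cone compact_K assms(2)])
    fix q x assume q: "q \<in> pos_cone K \<alpha>" and x: "x \<in> K"
    have "((\<lambda>q. lin_comb \<alpha> q x) has_derivative (\<lambda>v. lin_comb \<alpha> v x)) (at q)"
      unfolding lin_comb_eq_inner by (auto intro!: derivative_eq_intros)
    from has_derivative_mult_right[OF has_derivative_power[OF Deriv.has_derivative_inverse[OF _ this]], of "h x" "Suc j"]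
    show "((\<lambda>q. h x * inverse (lin_comb \<alpha> q x) ^ Suc j) has_derivative (\<lambda>v. ?\<phi> q x \<bullet> v)) (at q)"
      using pos_coneD[OF q x]
      by (simp add: lin_comb_eq_inner[of _ _ x] inner_commute[of "?a x"] algebra_simps del: of_nat_Suc)
  next
    fix q assume q: "q \<in> pos_cone K \<alpha>"
    show "continuous_on K (\<lambda>x. h x * inverse (lin_comb \<alpha> q x) ^ Suc j)"
      using pos_coneD[OF q] by (intro continuous_intros assms continuous_lin_comb) fastforce
  next
    let ?Z = "pos_cone K \<alpha> \<times> K"
    have h: "continuous_on ?Z (\<lambda>z. h (snd z))"
      by (rule continuous_on_compose2[OF assms(1) continuous_on_snd]) (auto intro: continuous_on_id)
    have al: "continuous_on ?Z (\<lambda>z. \<alpha> k (snd z))" for k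
      by (rule continuous_on_compose2[OF continuous_\<alpha> continuous_on_snd]) (auto intro: continuous_on_id)
    have L: "continuous_on ?Z (\<lambda>z. lin_comb \<alpha> (fst z) (snd z))"
      unfolding lin_comb_def by (intro continuous_intros al)
    have "continuous_on ?Z (\<lambda>z. ?\<phi> (fst z) (snd z))"
      using pos_coneD by (intro continuous_intros h L continuous_on_vec_lambda al) fastforce
    then show "continuous_on ?Z (\<lambda>(q, x). ?\<phi> q x)"
      by (simp add: case_prod_unfold)
  qed
  moreover have *: "?\<phi> q x \<bullet> v = - real (Suc j) * h x * lin_comb \<alpha> v x * inverse (lin_comb \<alpha> q x) ^ Suc (Suc j)" for x v
    by (simp add: lin_comb_eq_inner[of _ v] inner_commute[of v] del: of_nat_Suc)
  ultimately show ?thesis unfolding * by blast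
qed

text \<open>Both \<open>h\<close> and \<open>j\<close> vary in the induction, since each derivative
  changes the weight and the exponent.\<close>

lemma C_k_on_recip_power_integral:
  assumes "continuous_on K h"
  shows "C_k_on m (pos_cone K \<alpha>) (\<lambda>q. LINT x:K|lborel. h x * inverse (lin_comb \<alpha> q x) ^ Suc j)"
  using assms
proof (induction m arbitrary: h j)
  case 0
  then show ?case
    unfolding C_k_on.simps
    by (intro continuous_at_imp_continuous_on ballI has_derivative_continuous)
      (rule has_derivative_recip_power_integral)
next
  case (Suc m)
  show ?case
  proof (rule C_k_on_SucI[OF open_pos_cone has_derivative_recip_power_integral[OF Suc.prems]])
    show "C_k_on m (pos_cone K \<alpha>) (\<lambda>q. LINT x:K|lborel.
        - real (Suc j) * h x * lin_comb \<alpha> v x * inverse (lin_comb \<alpha> q x) ^ Suc (Suc j))" for v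
      by (intro Suc.IH continuous_on_mult continuous_on_const Suc.prems continuous_lin_comb)
  qed
qed

lemma smooth_on_moment_map: "smooth_on (pos_cone K \<alpha>) (moment_map K \<alpha> p)"
proof -
  \<comment> \<open>The components of the moment map are the case \<open>j = 0\<close> with weight
    \<open>\<alpha> k x * P x\<close>.\<close>
  have "C_k_on m (pos_cone K \<alpha>) (\<lambda>q. \<chi> k. LINT x:K|lborel.
      (\<alpha> k x * lin_comb \<alpha> p x) * inverse (lin_comb \<alpha> q x) ^ Suc 0)" for m
    by (intro C_k_on_vec_lambda open_pos_cone C_k_on_recip_power_integral continuous_on_mult
        continuous_\<alpha> continuous_lin_comb)
  then show ?thesis
    by (simp add: smooth_on_def moment_map_def[abs_def] divide_inverse mult.assoc)
qed

lemma moment_map_derivative_injective: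
  assumes p: "p \<in> pos_cone K \<alpha>" and q: "q \<in> pos_cone K \<alpha>"
    and zero: "frechet_derivative (moment_map K \<alpha> p) (at q) v = 0"
  shows "v = 0"
proof (rule ccontr)
  assume "v \<noteq> 0"
  then obtain x0 where x0: "x0 \<in> K" "lin_comb \<alpha> v x0 \<noteq> 0" using lin_comb_nonzero by blast
  let ?P = "lin_comb \<alpha> p" and ?Q = "lin_comb \<alpha> q" and ?V = "lin_comb \<alpha> v"
  let ?F = "\<lambda>q. LINT x:K|lborel. (?V x * ?P x) * inverse (lin_comb \<alpha> q x) ^ Suc 0"
  let ?D = "\<lambda>w. LINT x:K|lborel. - real (Suc 0) * (?V x * ?P x) * lin_comb \<alpha> w x * inverse (?Q x) ^ Suc (Suc 0)"
  have "C_k_on (Suc 0) (pos_cone K \<alpha>) (moment_map K \<alpha> p)"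
    using smooth_on_moment_map unfolding smooth_on_def by blast
  then have "(moment_map K \<alpha> p has_derivative frechet_derivative (moment_map K \<alpha> p) (at q)) (at q)"
    using q by (simp add: frechet_derivative_works)
  \<comment> \<open>The pairing with \<open>v\<close> is differentiated twice over, abstractly here
    and under the integral as \<open>?D\<close> below; uniqueness of derivatives equates the
    results.\<close>
  then have 1: "((\<lambda>q. v \<bullet> moment_map K \<alpha> p q) has_derivative
      (\<lambda>w. v \<bullet> frechet_derivative (moment_map K \<alpha> p) (at q) w)) (at q)"
    by (rule has_derivative_inner_right)
  have "(?F has_derivative ?D) (at q)"
    by (intro has_derivative_recip_power_integral q continuous_on_mult continuous_lin_comb)
  then have "((\<lambda>q. v \<bullet> moment_map K \<alpha> p q) has_derivative ?D) (at q)"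
    by (rule has_derivative_transform_within_open[OF _ open_pos_cone q])
      (simp add: inner_moment_map divide_inverse mult.assoc)
  from has_derivative_unique[OF 1 this] have "?D v = v \<bullet> frechet_derivative (moment_map K \<alpha> p) (at q) v"
    by metis
  then have "?D v = 0" using zero by simp
  moreover have "?D v = - (LINT x:K|lborel. (?V x)\<^sup>2 * (?P x / ?Q x / ?Q x))"
    by (simp add: set_lebesgue_integral_def power2_eq_square divide_inverse ac_simps
        flip: Bochner_Integration.integral_minus)
  moreover have "(LINT x:K|lborel. (?V x)\<^sup>2 * (?P x / ?Q x / ?Q x)) > 0"
  proof (rule set_integral_pos_compact[OF compact_K K_subset _ _ x0(1)])
    show "continuous_on K (\<lambda>x. (?V x)\<^sup>2 * (?P x / ?Q x / ?Q x))"
      by (intro continuous_on_mult continuous_on_power continuous_lin_comb continuous_quotient q)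
    show "0 \<le> (?V x)\<^sup>2 * (?P x / ?Q x / ?Q x)" if "x \<in> K" for x
      using pos_coneD[OF p that] pos_coneD[OF q that] by simp
    show "(?V x0)\<^sup>2 * (?P x0 / ?Q x0 / ?Q x0) \<noteq> 0"
      using pos_coneD[OF p x0(1)] pos_coneD[OF q x0(1)] x0(2) by simp
  qed
  ultimately show False by linarith
qed

section \<open>Closedness of the image and surjectivity\<close>

text \<open>Fatou's lemma: the functions \<open>1 / Q_n\<close> converge pointwise in
  \<open>ennreal\<close>, also where the limit form vanishes and the reciprocal is infinite.\<close>

lemma recip_integral_limit_le:
  assumes qn: "\<And>n. q n \<in> pos_cone K \<alpha>" and lim: "q \<longlonglongrightarrow> l"
    and B: "\<And>n. (LINT x:K|lborel. 1 / lin_comb \<alpha> (q n) x) \<le> B"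
  shows "recip_integral K \<alpha> l \<le> ennreal B"
proof -
  define u where "u n x = ennreal (indicator K x *\<^sub>R (1 / lin_comb \<alpha> (q n) x))" for n x
  have int: "integrable lborel (\<lambda>x. indicator K x *\<^sub>R (1 / lin_comb \<alpha> (q n) x))" for n
    by (intro borel_integrable_compact compact_K continuous_quotient qn continuous_on_const)
  have u_int: "(\<integral>\<^sup>+x. u n x \<partial>lborel) \<le> ennreal B" for n
  proof -
    have "0 \<le> indicator K x *\<^sub>R (1 / lin_comb \<alpha> (q n) x)" for x
      using pos_coneD[OF qn[of n], of x] by (cases "x \<in> K") auto
    then have "(\<integral>\<^sup>+x. u n x \<partial>lborel) = ennreal (LINT x:K|lborel. 1 / lin_comb \<alpha> (q n) x)"
      unfolding u_def set_lebesgue_integral_def by (intro nn_integral_eq_integral int) simp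
    then show ?thesis using B ennreal_leI by metis
  qed
  have lim_u: "liminf (\<lambda>n. u n x) = 1 / ennreal (lin_comb \<alpha> l x) * indicator K x" for x
  proof (cases "x \<in> K")
    case True
    have "(\<lambda>n. lin_comb \<alpha> (q n) x) \<longlonglongrightarrow> lin_comb \<alpha> l x"
      unfolding lin_comb_eq_inner by (intro tendsto_intros lim)
    \<comment> \<open>Inversion is continuous on all of \<open>ennreal\<close>, including at 0, so
      zeros of the limit need no separate case.\<close>
    then have "(\<lambda>n. inverse (ennreal (lin_comb \<alpha> (q n) x))) \<longlonglongrightarrow> inverse (ennreal (lin_comb \<alpha> l x))"
      using continuous_on_inverse_ennreal[OF continuous_on_id, of UNIV] tendsto_ennrealI
      by (metis UNIV_I continuous_on_tendsto_compose eventually_sequentiallyI)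
    moreover have "u n x = inverse (ennreal (lin_comb \<alpha> (q n) x))" for n
      using True pos_coneD[OF qn True] by (simp add: u_def inverse_ennreal inverse_eq_divide)
    ultimately have "(\<lambda>n. u n x) \<longlonglongrightarrow> inverse (ennreal (lin_comb \<alpha> l x))" by simp
    then show ?thesis
      using True by (simp add: lim_imp_Liminf divide_ennreal_def)
  next
    case False
    then show ?thesis by (simp add: u_def Liminf_const)
  qed
  have "recip_integral K \<alpha> l = (\<integral>\<^sup>+x. liminf (\<lambda>n. u n x) \<partial>lborel)"
    by (simp add: recip_integral_def lim_u)
  also have "\<dots> \<le> liminf (\<lambda>n. \<integral>\<^sup>+x. u n x \<partial>lborel)"
    unfolding u_def using int by (intro nn_integral_liminf) (auto intro: borel_measurable_integrable)
  also have "\<dots> \<le> liminf (\<lambda>n::nat. ennreal B)"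
    by (intro Liminf_mono always_eventually allI u_int)
  also have "\<dots> = ennreal B" by (simp add: Liminf_const)
  finally show ?thesis .
qed

lemma moment_map_preimages_bounded:
  assumes p: "p \<in> pos_cone K \<alpha>" and q: "\<And>n. q n \<in> pos_cone K \<alpha>"
    and lim: "(\<lambda>n. moment_map K \<alpha> p (q n)) \<longlonglongrightarrow> c" and c: "c \<in> dual_cone K \<alpha>"
  shows "bounded (range q)"
proof -
  obtain \<epsilon> where \<epsilon>: "\<epsilon> > 0" "\<And>r. r \<in> closure (pos_cone K \<alpha>) \<Longrightarrow> \<epsilon> * norm r \<le> c \<bullet> r"
    using dual_cone_margin[OF c] by blast
  let ?I = "LINT x:K|lborel. lin_comb \<alpha> p x"
  \<comment> \<open>Replacing \<open>c\<close> by the nearby value costs half of the margin; the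
    other half bounds \<open>norm (q n)\<close> by means of the constant pairing
    \<open>?I\<close>.\<close>
  have "\<forall>\<^sub>F n in sequentially. dist (moment_map K \<alpha> p (q n)) c < \<epsilon> / 2"
    using \<epsilon>(1) lim by (intro tendstoD) auto
  then have "\<forall>\<^sub>F n in sequentially. norm (q n) \<le> 2 * ?I / \<epsilon>"
  proof eventually_elim
    case (elim n)
    have "q n \<bullet> moment_map K \<alpha> p (q n) = ?I"
      unfolding inner_moment_map[OF q]
    proof (intro set_lebesgue_integral_cong ballI allI impI)
      show "lin_comb \<alpha> (q n) x * (lin_comb \<alpha> p x / lin_comb \<alpha> (q n) x) = lin_comb \<alpha> p x" if "x \<in> K" for x
        using pos_coneD[OF q that, of n] by simp
    qed (simp add: borel_compact compact_K)
    moreover have "(c - moment_map K \<alpha> p (q n)) \<bullet> q n \<le> norm (c - moment_map K \<alpha> p (q n)) * norm (q n)"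
      by (rule norm_cauchy_schwarz)
    moreover have "\<dots> \<le> \<epsilon> / 2 * norm (q n)"
      using elim by (intro mult_right_mono) (auto simp: dist_norm norm_minus_commute)
    moreover have "\<epsilon> * norm (q n) \<le> c \<bullet> q n"
      using \<epsilon>(2) q closure_subset by blast
    ultimately have "\<epsilon> / 2 * norm (q n) \<le> ?I"
      by (simp add: inner_diff_left inner_diff_right inner_commute)
    then show ?case using \<epsilon>(1) by (simp add: field_simps)
  qed
  then obtain N where N: "\<And>n. n \<ge> N \<Longrightarrow> norm (q n) \<le> 2 * ?I / \<epsilon>"
    unfolding eventually_sequentially by blast
  have "range q \<subseteq> q ` {..<N} \<union> cball 0 (2 * ?I / \<epsilon>)"
  proof
    fix y assume "y \<in> range q"
    then obtain n where "y = q n" by blast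
    then show "y \<in> q ` {..<N} \<union> cball 0 (2 * ?I / \<epsilon>)"
      using N[of n] by (cases "n < N") auto
  qed
  then show ?thesis
    using bounded_subset finite_imp_bounded bounded_Un bounded_cball by (metis finite_imageI finite_lessThan)
qed

text \<open>The image is shown to be open and closed relative to the connected dual cone; it is
  nonempty because \<open>p\<close> itself lies in the domain.\<close>

lemma moment_map_surj:
  assumes p: "p \<in> pos_cone K \<alpha>"
    and blow_up: "\<And>q. q \<in> pos_cone_boundary K \<alpha> \<Longrightarrow> recip_integral K \<alpha> q = \<infinity>"
  shows "moment_map K \<alpha> p ` pos_cone K \<alpha> = dual_cone K \<alpha>"
proof -
  let ?S = "pos_cone K \<alpha>" and ?C = "dual_cone K \<alpha>" and ?f = "moment_map K \<alpha> p"
  have "C_k_on 0 ?S ?f" using smooth_on_moment_map unfolding smooth_on_def by blast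
  then have cont: "continuous_on ?S ?f" by simp
  have "open (?f ` ?S)"
    by (rule invariance_of_domain[OF cont open_pos_cone inj_on_moment_map[OF p]])
  moreover have sub: "?f ` ?S \<subseteq> ?C" using moment_map_in_dual_cone[OF p] by blast
  ultimately have 1: "openin (top_of_set ?C) (?f ` ?S)"
    by (simp add: open_subset)
  have "c \<in> ?f ` ?S" if c: "c \<in> ?C" "c \<in> closure (?f ` ?S)" for c
  proof -
    obtain y where y: "\<And>n. y n \<in> ?f ` ?S" "y \<longlonglongrightarrow> c"
      using c(2) unfolding closure_sequential by blast
    then have "\<exists>q. \<forall>n. q n \<in> ?S \<and> y n = ?f (q n)" by (intro choice) blast
    then obtain q where q: "\<And>n. q n \<in> ?S" "\<And>n. y n = ?f (q n)" by blast
    have lim: "(\<lambda>n. ?f (q n)) \<longlonglongrightarrow> c" using y(2) unfolding q(2)[symmetric] .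
    obtain l \<sigma> where \<sigma>: "strict_mono \<sigma>" "(q \<circ> \<sigma>) \<longlonglongrightarrow> l"
      using bounded_imp_convergent_subsequence[OF moment_map_preimages_bounded[OF p q(1) lim c(1)]] by blast
    have lim\<sigma>: "(\<lambda>n. ?f ((q \<circ> \<sigma>) n)) \<longlonglongrightarrow> c"
      using LIMSEQ_subseq_LIMSEQ[OF lim \<sigma>(1)] by (simp add: o_def)
    have q\<sigma>: "(q \<circ> \<sigma>) n \<in> ?S" for n using q(1) by simp
    have "l \<in> closure ?S"
      using \<sigma>(2) q\<sigma> unfolding closure_sequential by blast
    moreover have "l \<notin> pos_cone_boundary K \<alpha>"
    proof
      assume "l \<in> pos_cone_boundary K \<alpha>"
      then have inf: "recip_integral K \<alpha> l = \<infinity>" by (rule blow_up)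
      obtain m where m: "m > 0" "\<And>x. x \<in> K \<Longrightarrow> m \<le> lin_comb \<alpha> p x"
        using pos_cone_lower_bound[OF p] by blast
      have "bounded (range (\<lambda>n. ?f ((q \<circ> \<sigma>) n)))"
        using lim\<sigma> convergent_imp_bounded by blast
      then obtain B where B: "\<And>n. norm (?f ((q \<circ> \<sigma>) n)) \<le> B"
        unfolding bounded_iff by blast
      \<comment> \<open>From \<open>P \<ge> m\<close> the integral of \<open>m^2 / Q_n\<close> is at
        most that of \<open>P^2 / Q_n\<close>, which is the pairing of \<open>p\<close> with a
        bounded sequence.\<close>
      have "(LINT x:K|lborel. 1 / lin_comb \<alpha> ((q \<circ> \<sigma>) n) x) \<le> norm p * B / m\<^sup>2" for n
      proof -
        let ?Q = "lin_comb \<alpha> ((q \<circ> \<sigma>) n)" and ?P = "lin_comb \<alpha> p"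
        have "m\<^sup>2 * (LINT x:K|lborel. 1 / ?Q x) = (LINT x:K|lborel. m\<^sup>2 * (1 / ?Q x))"
          by (rule set_integral_mult_right[symmetric])
        also have "\<dots> \<le> (LINT x:K|lborel. ?P x * (?P x / ?Q x))"
        proof (rule set_integral_mono)
          show "set_integrable lborel K (\<lambda>x. m\<^sup>2 * (1 / ?Q x))"
            "set_integrable lborel K (\<lambda>x. ?P x * (?P x / ?Q x))"
            by (intro set_integrable_continuous_compact compact_K continuous_on_mult
                continuous_on_const continuous_quotient q\<sigma> continuous_lin_comb)+
          fix x assume x: "x \<in> K"
          have "m * m \<le> ?P x * ?P x"
            using m(1) m(2)[OF x] by (intro mult_mono) auto
          then show "m\<^sup>2 * (1 / ?Q x) \<le> ?P x * (?P x / ?Q x)"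
            using pos_coneD[OF q\<sigma> x] by (simp add: divide_right_mono power2_eq_square less_imp_le)
        qed
        also have "\<dots> = p \<bullet> ?f ((q \<circ> \<sigma>) n)"
          by (simp only: inner_moment_map[OF q\<sigma>])
        also have "\<dots> \<le> norm p * norm (?f ((q \<circ> \<sigma>) n))"
          by (rule norm_cauchy_schwarz)
        also have "\<dots> \<le> norm p * B"
          by (intro mult_left_mono B) simp
        finally show ?thesis using m(1) by (simp add: field_simps)
      qed
      then have "recip_integral K \<alpha> l \<le> ennreal (norm p * B / m\<^sup>2)"
        by (intro recip_integral_limit_le[OF q\<sigma> \<sigma>(2)])
      then show False using inf by (simp add: top_unique)
    qed
    ultimately have l: "l \<in> ?S" by (simp add: pos_cone_boundary_def)
    have "(\<lambda>n. ?f ((q \<circ> \<sigma>) n)) \<longlonglongrightarrow> ?f l"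
      using continuous_on_tendsto_compose[OF cont \<sigma>(2) l] q\<sigma> by simp
    then show ?thesis
      using LIMSEQ_unique[OF lim\<sigma>] l by blast
  qed
  then have "?f ` ?S = ?C \<inter> closure (?f ` ?S)"
    using sub closure_subset[of "?f ` ?S"] by blast
  then have 2: "closedin (top_of_set ?C) (?f ` ?S)"
    unfolding closedin_closed by blast
  have "connected ?C" by (simp add: convex_connected convex_dual_cone)
  then show ?thesis
    using 1 2 p unfolding connected_clopen by blast
qed

end

theorem theorem3p4:
  fixes K :: "(real ^ 'd) set"
    and \<alpha> :: "'n::finite \<Rightarrow> real ^ 'd \<Rightarrow> real"
    and p :: "real ^ 'n"
  assumes "compact K"
    and "interior K \<noteq> {}"
    and "closure (interior K) = K"
    and "\<And>k. continuous_on K (\<alpha> k)"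
    and "lin_indep_on K \<alpha>"
    and "\<And>r. r \<in> closure (pos_cone K \<alpha>) - {0} \<Longrightarrow>
           {x \<in> K. lin_comb \<alpha> r x = 0} \<in> null_sets lebesgue"
    and "pos_cone K \<alpha> \<noteq> {}"
    and "\<And>q. q \<in> pos_cone_boundary K \<alpha> \<Longrightarrow> recip_integral K \<alpha> q = \<infinity>"
    and "p \<in> pos_cone K \<alpha>"
  shows "diffeomorphism_between (pos_cone K \<alpha>) (dual_cone K \<alpha>) (moment_map K \<alpha> p)"
proof -
  interpret positive_cone K \<alpha>
    using assms(1-5) interior_subset by unfold_locales auto
  \<comment> \<open>Openness of the dual cone comes along with this, once surjectivity identifies it
    with the open image.\<close>
  have "diffeomorphism_between (pos_cone K \<alpha>) (moment_map K \<alpha> p ` pos_cone K \<alpha>) (moment_map K \<alpha> p)"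
    by (rule diffeomorphism_between_image[OF open_pos_cone inj_on_moment_map[OF assms(9)]
          smooth_on_moment_map moment_map_derivative_injective[OF assms(9)]])
  then show ?thesis
    using moment_map_surj[OF assms(9,8)] by simp
qed

end
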